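(* Assume $r\ge2$, let $\eta:[0,\infty)\to[0,\infty)$ be a homeomorphism and let $F:(\mathbb{R}^n,D)\to(\mathbb{R}^n,D)$ be an $\eta$-quasisymmetric homeomorphism. Then $F$ is a $K$-quasisimilarity with $K=(\eta(1)/\eta^{-1}(1))^{2r+2}$, i.e. there is $C>0$ with $\frac{C}{K}D(x,y)\le D(F(x),F(y))\le CK\,D(x,y)$ for all $x,y\in\mathbb{R}^n$.
   Context: Let $n_1,\dots,n_r\ge1$, $n=n_1+\dots+n_r$, $\mathbb{R}^n=\mathbb{R}^{n_1}\times\dots\times\mathbb{R}^{n_r}$, and $0<\alpha_1<\dots<\alpha_r$. For $x=(x_1,\dots,x_r)$, $y=(y_1,\dots,y_r)$ with $x_i,y_i\in\mathbb{R}^{n_i}$, $D(x,y)=\max\{|x_1-y_1|,|x_2-y_2|^{\alpha_1/\alpha_2},\dots,|x_r-y_r|^{\alpha_1/\alpha_r}\}$, $|\cdot|$ the Euclidean norm; $D$ is a metric. A homeomorphism $f$ between metric spaces is $\eta$-quasisymmetric if $\frac{d(f(x),f(y))}{d(f(x),f(z))}\le\eta\big(\frac{d(x,y)}{d(x,z)}\big)$ for all distinct $x,y,z$. For $K\ge1$, $C>0$, a bijection $F$ is a $K$-quasisimilarity with constant $C$ if $\frac CK d(x,y)\le d(F(x),F(y))\le CK\,d(x,y)$ for all $x,y$. *)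

theory Defs
  imports "HOL-Analysis.Analysis"
begin

text \<open>A point of R^n = R^{n_1} x ... x R^{n_r} is represented as a function
  x :: nat => nat => real, where x i j is the j-th coordinate (j < ns i) of the
  i-th block (i < r); blocks are indexed 0..r-1.  All other entries are 0.\<close>

definition pspace :: "(nat \<Rightarrow> nat) \<Rightarrow> nat \<Rightarrow> (nat \<Rightarrow> nat \<Rightarrow> real) set" where
  "pspace ns r = {x. \<forall>i j. (r \<le> i \<or> ns i \<le> j) \<longrightarrow> x i j = 0}"

definition blockdist :: "(nat \<Rightarrow> nat) \<Rightarrow> nat \<Rightarrow> (nat \<Rightarrow> nat \<Rightarrow> real) \<Rightarrow> (nat \<Rightarrow> nat \<Rightarrow> real) \<Rightarrow> real" where
  "blockdist ns i x y = sqrt (\<Sum>j<ns i. (x i j - y i j)\<^sup>2)"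

definition Dmet :: "(nat \<Rightarrow> real) \<Rightarrow> (nat \<Rightarrow> nat) \<Rightarrow> nat \<Rightarrow> (nat \<Rightarrow> nat \<Rightarrow> real) \<Rightarrow> (nat \<Rightarrow> nat \<Rightarrow> real) \<Rightarrow> real" where
  "Dmet \<alpha> ns r x y = Max ((\<lambda>i. blockdist ns i x y powr (\<alpha> 0 / \<alpha> i)) ` {..<r})"

definition dcontinuous_on :: "('a \<Rightarrow> 'a \<Rightarrow> real) \<Rightarrow> 'a set \<Rightarrow> ('b \<Rightarrow> 'b \<Rightarrow> real) \<Rightarrow> ('a \<Rightarrow> 'b) \<Rightarrow> bool" where
  "dcontinuous_on d X d' f = (\<forall>x\<in>X. \<forall>e>0. \<exists>\<delta>>0. \<forall>y\<in>X. d x y < \<delta> \<longrightarrow> d' (f x) (f y) < e)"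

definition dhomeomorphism :: "('a \<Rightarrow> 'a \<Rightarrow> real) \<Rightarrow> 'a set \<Rightarrow> ('b \<Rightarrow> 'b \<Rightarrow> real) \<Rightarrow> 'b set \<Rightarrow> ('a \<Rightarrow> 'b) \<Rightarrow> bool" where
  "dhomeomorphism d X d' Y f = (bij_betw f X Y \<and> dcontinuous_on d X d' f \<and>
      dcontinuous_on d' Y d (inv_into X f))"

definition quasisymmetric :: "(real \<Rightarrow> real) \<Rightarrow> ('a \<Rightarrow> 'a \<Rightarrow> real) \<Rightarrow> 'a set \<Rightarrow> ('b \<Rightarrow> 'b \<Rightarrow> real) \<Rightarrow> 'b set \<Rightarrow> ('a \<Rightarrow> 'b) \<Rightarrow> bool" where
  "quasisymmetric \<eta> d X d' Y f = (dhomeomorphism d X d' Y f \<and>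
     (\<forall>x\<in>X. \<forall>y\<in>X. \<forall>z\<in>X. x \<noteq> y \<and> x \<noteq> z \<and> y \<noteq> z \<longrightarrow>
        d' (f x) (f y) / d' (f x) (f z) \<le> \<eta> (d x y / d x z)))"

definition quasisimilarity :: "real \<Rightarrow> real \<Rightarrow> ('a \<Rightarrow> 'a \<Rightarrow> real) \<Rightarrow> 'a set \<Rightarrow> ('b \<Rightarrow> 'b \<Rightarrow> real) \<Rightarrow> 'b set \<Rightarrow> ('a \<Rightarrow> 'b) \<Rightarrow> bool" where
  "quasisimilarity K C d X d' Y f = (bij_betw f X Y \<and>
     (\<forall>x\<in>X. \<forall>y\<in>X. C / K * d x y \<le> d' (f x) (f y) \<and> d' (f x) (f y) \<le> C * K * d x y))"

end

theory Submission
  imports Defs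
begin

text \<open>
  Call the sets on which all blocks except the first are constant leaves, and put
  \<open>s\<^sub>i = \<alpha>\<^sub>i / \<alpha>\<^sub>0\<close> and \<open>A = \<eta> 1\<close>.

  Leaves go to leaves.  Suppose that the image of a horizontal segment moves in a block \<open>i \<ge> 1\<close>.
  Take a \<open>D\<close>-grid of mesh \<open>\<epsilon> = L / m\<close> around the segment and let \<open>d\<close> be the image length of a
  horizontal grid edge.  Quasisymmetry makes the \<open>D\<close>-balls of radius \<open>d / 2A\<close> around the image
  points disjoint, so comparing volumes bounds \<open>\<Sum> d\<^sup>Q\<close> by a constant, where \<open>Q\<close> is the homogeneous dimension.
  Each of the roughly \<open>m\<^bsup>Q-1\<^esup>\<close> columns has \<open>\<Sum> d\<^bsup>s\<^sub>i\<^esup>\<close> bounded below, because the \<open>i\<close>-th block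
  is a snowflake with \<open>s\<^sub>i > 1\<close>; for large \<open>m\<close> the two bounds contradict each other.

  Distances on a leaf.  Distances from a point to a leaf do not depend on the point chosen in its own
  leaf; comparing horizontal steps of length \<open>\<rho>\<close> with a leaf at distance \<open>\<rho>\<close> shows that, within one
  leaf, a step that is not longer than another has image at most \<open>A\<^sup>2\<close> times as long.  Subdividing one
  segment in the source and another one in the image turns this into a comparison of the ratios
  \<open>D(Fx,Fy) / D(x,y)\<close> on a leaf, up to \<open>A\<^sup>2\<close>.  Hence two pairs with a common point have ratios comparable
  up to \<open>A\<^sup>4\<close>, any two pairs up to \<open>A\<^sup>8\<close>, and \<open>F\<close> is an \<open>A\<^sup>4\<close>-quasisimilarity.
\<close>

section \<open>The metric \<open>D\<close> and its balls\<close>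

text \<open>Write \<open>x powr s\<close> as \<open>x * x powr (s - 1)\<close>, whose second factor
  is monotone. This gives \<open>D\<close> its triangle inequality.\<close>

lemma powr_superadd:
  fixes a b s :: real
  assumes "0 \<le> a" "0 \<le> b" "1 \<le> s"
  shows "a powr s + b powr s \<le> (a + b) powr s"
proof -
  have split: "x powr s = x * x powr (s - 1)" if "0 \<le> x" for x :: real
    using that powr_mult_base[of x "s - 1"] by simp
  have "a powr s + b powr s \<le> a * (a + b) powr (s - 1) + b * (a + b) powr (s - 1)"
    unfolding split[OF assms(1)] split[OF assms(2)]
    using assms by (intro add_mono mult_left_mono powr_mono2) auto
  also have "\<dots> = (a + b) powr s"
    using assms by (simp add: split[of "a + b"] distrib_right)
  finally show ?thesis .
qed

locale block_space =
  fixes ns :: "nat \<Rightarrow> nat" and r :: nat and \<alpha> :: "nat \<Rightarrow> real"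
  assumes r2: "r \<ge> 2"
    and ns_pos: "\<forall>i<r. ns i \<ge> 1"
    and alpha_pos: "0 < \<alpha> 0"
    and alpha_mono: "\<forall>i j. i < j \<and> j < r \<longrightarrow> \<alpha> i < \<alpha> j"
begin

abbreviation D where "D \<equiv> Dmet \<alpha> ns r"
abbreviation X where "X \<equiv> pspace ns r"
text \<open>Scaling exponent of block \<open>i\<close>: \<open>D\<close>-size \<open>t\<close>
  corresponds to Euclidean size \<open>t powr s i\<close>, and \<open>s 0 = 1\<close>.\<close>

abbreviation s where "s i \<equiv> \<alpha> i / \<alpha> 0"
abbreviation I where "I \<equiv> Sigma {..<r} (\<lambda>i. {..<ns i})"

text \<open>Entries outside the index range vanish on \<open>X\<close>, so for points of
  \<open>X\<close> this means that blocks \<open>1\<close> to \<open>r - 1\<close> agree.\<close>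

definition same_leaf :: "(nat \<Rightarrow> nat \<Rightarrow> real) \<Rightarrow> (nat \<Rightarrow> nat \<Rightarrow> real) \<Rightarrow> bool" where
  "same_leaf x y \<longleftrightarrow> (\<forall>i j. i \<noteq> 0 \<longrightarrow> x i j = y i j)"

definition translate :: "nat \<Rightarrow> nat \<Rightarrow> real \<Rightarrow> (nat \<Rightarrow> nat \<Rightarrow> real) \<Rightarrow> nat \<Rightarrow> nat \<Rightarrow> real" where
  "translate i j t x = x(i := (x i)(j := x i j + t))"

lemma s_gt_1: "0 < i \<Longrightarrow> i < r \<Longrightarrow> 1 < s i"
  using alpha_mono alpha_pos by (auto simp: field_simps)

lemma s_ge_1: "i < r \<Longrightarrow> 1 \<le> s i"
  by (cases "i = 0") (use s_gt_1[of i] alpha_pos in auto)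

lemma blockdist_nonneg [simp]: "0 \<le> blockdist ns i x y"
  by (simp add: blockdist_def sum_nonneg)

lemma blockdist_L2: "blockdist ns i x y = L2_set (\<lambda>j. x i j - y i j) {..<ns i}"
  by (simp add: blockdist_def L2_set_def)

lemma coord_le_blockdist: "j < ns i \<Longrightarrow> \<bar>x i j - y i j\<bar> \<le> blockdist ns i x y"
  unfolding blockdist_L2
  using member_le_L2_set[of "{..<ns i}" j "\<lambda>j. \<bar>x i j - y i j\<bar>"] by (simp add: L2_set_def)

lemma blockdist_le_sum: "blockdist ns i x y \<le> (\<Sum>j<ns i. \<bar>x i j - y i j\<bar>)"
  unfolding blockdist_L2 by (rule L2_set_le_sum_abs)

lemma blockdist_triangle: "blockdist ns i x z \<le> blockdist ns i x y + blockdist ns i y z"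
  unfolding blockdist_L2
  using L2_set_triangle_ineq[of "\<lambda>j. x i j - y i j" "\<lambda>j. y i j - z i j" "{..<ns i}"] by simp

lemma powr_block_le_iff:
  assumes "i < r" "0 \<le> u" "0 \<le> t"
  shows "u powr (\<alpha> 0 / \<alpha> i) \<le> t \<longleftrightarrow> u \<le> t powr s i"
proof -
  have s: "0 < s i" using s_ge_1[OF assms(1)] by linarith
  have e: "\<alpha> 0 / \<alpha> i * s i = 1" "\<alpha> 0 / \<alpha> i > 0" using s alpha_pos by (auto simp: zero_less_divide_iff)
  have "(u powr (\<alpha> 0 / \<alpha> i)) powr s i = u" using e assms by (simp add: powr_powr)
  then have "u \<le> t powr s i \<longleftrightarrow> (u powr (\<alpha> 0 / \<alpha> i)) powr s i \<le> t powr s i" by simp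
  also have "\<dots> \<longleftrightarrow> u powr (\<alpha> 0 / \<alpha> i) \<le> t"
    using s assms powr_less_mono2[of "s i" t "u powr (\<alpha> 0 / \<alpha> i)"]
    by (smt (verit) powr_ge_zero powr_mono2)
  finally show ?thesis by simp
qed

lemma D_nonneg [simp]: "0 \<le> D x y"
proof -
  have "blockdist ns 0 x y powr (\<alpha> 0 / \<alpha> 0) \<le> D x y"
    unfolding Dmet_def using r2 by (intro Max_ge imageI finite_imageI) auto
  then show ?thesis by (meson order_trans powr_ge_zero)
qed

text \<open>The working form of \<open>D\<close>: its closed balls are products of Euclidean balls
  of radii \<open>t powr s i\<close>, which lets most estimates avoid the maximum and the exponents
  below 1.\<close>

lemma D_le_iff:
  assumes "0 \<le> t"
  shows "D x y \<le> t \<longleftrightarrow> (\<forall>i<r. blockdist ns i x y \<le> t powr s i)"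
proof -
  have "D x y \<le> t \<longleftrightarrow> (\<forall>i<r. blockdist ns i x y powr (\<alpha> 0 / \<alpha> i) \<le> t)"
    unfolding Dmet_def using r2 by (subst Max_le_iff) (auto simp: lessThan_empty_iff)
  then show ?thesis using assms powr_block_le_iff by auto
qed

lemma blockdist_le_D: "i < r \<Longrightarrow> blockdist ns i x y \<le> D x y powr s i"
  using D_le_iff[of "D x y" x y] by simp

lemma coord_le_D: "i < r \<Longrightarrow> j < ns i \<Longrightarrow> \<bar>x i j - y i j\<bar> \<le> D x y powr s i"
  using coord_le_blockdist blockdist_le_D order_trans by blast

lemma D_geI:
  assumes "i < r" "0 \<le> t" "t powr s i \<le> blockdist ns i x y"
  shows "t \<le> D x y"
proof -
  have "t powr s i \<le> D x y powr s i" using assms blockdist_le_D order_trans by blast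
  then show ?thesis using s_ge_1[OF assms(1)] assms(2)
    by (smt (verit) D_nonneg powr_less_mono2)
qed

lemma D_commute: "D x y = D y x"
proof -
  have "blockdist ns i x y = blockdist ns i y x" for i
    unfolding blockdist_def by (simp add: power2_commute)
  then show ?thesis unfolding Dmet_def by simp
qed

lemma D_triangle: "D x z \<le> D x y + D y z"
proof -
  have "blockdist ns i x z \<le> (D x y + D y z) powr s i" if "i < r" for i
    using blockdist_triangle[of i x z y] blockdist_le_D[OF that, of x y]
      blockdist_le_D[OF that, of y z] powr_superadd[OF D_nonneg D_nonneg s_ge_1[OF that], of x y y z]
    by linarith
  then show ?thesis using D_le_iff[of "D x y + D y z" x z] by simp
qed

lemma D_self [simp]: "D x x = 0"
  using D_le_iff[of 0 x x] by (simp add: blockdist_def antisym)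

lemma X_eqI: "x \<in> X \<Longrightarrow> y \<in> X \<Longrightarrow> (\<And>i j. i < r \<Longrightarrow> j < ns i \<Longrightarrow> x i j = y i j) \<Longrightarrow> x = y"
  unfolding pspace_def by (intro ext) (metis (mono_tags, lifting) mem_Collect_eq not_le)

lemma D_eq_0_iff:
  assumes "x \<in> X" "y \<in> X"
  shows "D x y = 0 \<longleftrightarrow> x = y"
proof
  assume "D x y = 0"
  then have "\<bar>x i j - y i j\<bar> \<le> 0" if "i < r" "j < ns i" for i j
    using coord_le_D[OF that, of x y] by simp
  then show "x = y" using assms by (intro X_eqI) auto
qed simp

lemma D_pos_iff: "x \<in> X \<Longrightarrow> y \<in> X \<Longrightarrow> 0 < D x y \<longleftrightarrow> x \<noteq> y"
  using D_eq_0_iff[of x y] D_nonneg[of x y] by linarith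

lemma translate_in_X: "x \<in> X \<Longrightarrow> i < r \<Longrightarrow> j < ns i \<Longrightarrow> translate i j t x \<in> X"
  by (auto simp: pspace_def translate_def)

lemma blockdist_translate:
  assumes "j < ns i"
  shows "blockdist ns i' x (translate i j t x) = (if i' = i then \<bar>t\<bar> else 0)"
proof (cases "i' = i")
  case True
  have "(\<Sum>k<ns i. (x i k - translate i j t x i k)\<^sup>2) = (\<Sum>k<ns i. if k = j then t\<^sup>2 else 0)"
    by (intro sum.cong) (auto simp: translate_def)
  also have "\<dots> = t\<^sup>2" using assms by simp
  finally show ?thesis using True by (simp add: blockdist_def)
qed (simp add: blockdist_def translate_def)

lemma D_translate:
  assumes "i < r" "j < ns i" "0 \<le> t"
  shows "D x (translate i j (t powr s i) x) = t"
proof (rule antisym)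
  show "D x (translate i j (t powr s i) x) \<le> t"
    using assms by (subst D_le_iff) (auto simp: blockdist_translate)
  show "t \<le> D x (translate i j (t powr s i) x)"
    using assms by (intro D_geI[of i]) (auto simp: blockdist_translate)
qed

text \<open>The other blocks contribute 0 and block 0 has exponent 1. Leaves are therefore
  Euclidean, and their segments can be divided evenly.\<close>

lemma D_same_leaf:
  assumes "same_leaf x y"
  shows "D x y = blockdist ns 0 x y"
proof (rule antisym)
  have "blockdist ns i x y \<le> blockdist ns 0 x y powr s i" if "i < r" for i
    using assms alpha_pos by (cases "i = 0") (auto simp: same_leaf_def blockdist_def sum_nonneg)
  then show "D x y \<le> blockdist ns 0 x y"
    by (subst D_le_iff) auto
  show "blockdist ns 0 x y \<le> D x y"
    using r2 alpha_pos by (intro D_geI[of 0]) auto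
qed


section \<open>Weak quasisymmetry and distances on a leaf\<close>

text \<open>Quasisymmetry at ratio 1 only; the product form stays meaningful when points
  coincide.\<close>

definition weakly_qs :: "real \<Rightarrow> ((nat \<Rightarrow> nat \<Rightarrow> real) \<Rightarrow> nat \<Rightarrow> nat \<Rightarrow> real) \<Rightarrow> bool" where
  "weakly_qs A f \<longleftrightarrow> (\<forall>x\<in>X. \<forall>y\<in>X. \<forall>z\<in>X. D x y \<le> D x z \<longrightarrow> D (f x) (f y) \<le> A * D (f x) (f z))"

lemma weakly_qsD:
  "weakly_qs A f \<Longrightarrow> D x y \<le> D x z \<Longrightarrow> x \<in> X \<Longrightarrow> y \<in> X \<Longrightarrow> z \<in> X \<Longrightarrow> D (f x) (f y) \<le> A * D (f x) (f z)"
  unfolding weakly_qs_def by blast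

lemma same_leaf_refl [simp]: "same_leaf x x"
  and same_leaf_sym: "same_leaf x y \<Longrightarrow> same_leaf y x"
  and same_leaf_trans: "same_leaf x y \<Longrightarrow> same_leaf y z \<Longrightarrow> same_leaf x z"
  by (auto simp: same_leaf_def)

text \<open>Cut the segment from \<open>x\<close> to \<open>y\<close> into \<open>m\<close> equal
  pieces; by the triangle inequality one of them has an image of at least average length. The map
  \<open>f\<close> is arbitrary since both \<open>F\<close> and its inverse will be
  inserted.\<close>

lemma subdivide_leaf:
  assumes "x \<in> X" "y \<in> X" "same_leaf x y" "0 < (m::nat)"
  obtains u v where "u \<in> X" "v \<in> X" "same_leaf x u" "same_leaf x v"
    "D u v = D x y / m" "D (f x) (f y) / m \<le> D (f u) (f v)"
proof -
  define w where "w k = (\<lambda>i j. x i j + real k / real m * (y i j - x i j))" for k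
  have w0: "w 0 = x" and wm: "w m = y" using assms(4) by (auto simp: w_def)
  have wX: "w k \<in> X" for k using assms by (auto simp: w_def pspace_def)
  have wl: "same_leaf x (w k)" for k using assms(3) by (auto simp: w_def same_leaf_def)
  have "D (w k) (w (Suc k)) = D x y / m" for k
  proof -
    have "blockdist ns 0 (w k) (w (Suc k)) = sqrt (\<Sum>j<ns 0. (1/m)\<^sup>2 * (x 0 j - y 0 j)\<^sup>2)"
      unfolding blockdist_def power_mult_distrib[symmetric]
      by (intro arg_cong[where f=sqrt] sum.cong) (auto simp: w_def add_divide_distrib algebra_simps)
    also have "\<dots> = blockdist ns 0 x y / m"
      unfolding sum_distrib_left[symmetric] real_sqrt_mult blockdist_def by simp
    finally show ?thesis
      using D_same_leaf[OF assms(3)] D_same_leaf[of "w k" "w (Suc k)"] wl same_leaf_sym same_leaf_trans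
      by metis
  qed
  moreover obtain k where "D (f x) (f y) / m \<le> D (f (w k)) (f (w (Suc k)))"
  proof (rule ccontr)
    assume *: "\<not> thesis"
    have "D (f (w 0)) (f (w n)) \<le> (\<Sum>k<n. D (f (w k)) (f (w (Suc k))))" for n
    proof (induction n)
      case (Suc n)
      then show ?case using D_triangle[of "f (w 0)" "f (w (Suc n))" "f (w n)"] by simp
    qed simp
    from this[of m] have "D (f x) (f y) \<le> (\<Sum>k<m. D (f (w k)) (f (w (Suc k))))"
      by (simp add: w0 wm)
    also have "\<dots> < (\<Sum>k<m. D (f x) (f y) / m)"
      using * that assms(4) by (intro sum_strict_mono) (auto intro: leI)
    also have "\<dots> = D (f x) (f y)" using assms(4) by simp
    finally show False by simp
  qed
  ultimately show thesis using that[of "w k" "w (Suc k)"] wX wl by blast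
qed

text \<open>\<open>y(0 := x 0)\<close> is a point of the leaf of \<open>y\<close> nearest to
  \<open>x\<close>: block 0 contributes nothing, and the other blocks depend only on the two
  leaves.\<close>

lemma D_fun_upd_le:
  assumes "same_leaf x x'" "same_leaf y y'"
  shows "D x (y(0 := x 0)) \<le> D x' y'"
proof (subst D_le_iff)
  show "\<forall>i<r. blockdist ns i x (y(0 := x 0)) \<le> D x' y' powr s i"
  proof safe
    fix i assume i: "i < r"
    show "blockdist ns i x (y(0 := x 0)) \<le> D x' y' powr s i"
    proof (cases "i = 0")
      case True
      then show ?thesis by (simp add: blockdist_def)
    next
      case False
      then have "blockdist ns i x (y(0 := x 0)) = blockdist ns i x' y'"
        using assms by (simp add: blockdist_def same_leaf_def)
      then show ?thesis using blockdist_le_D[OF i, of x' y'] by simp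
    qed
  qed
qed simp

text \<open>A second leaf, shifted by \<rho> in block 1, links the two steps. The image step at
  \<open>p\<close> is at most \<open>A\<close> times the distance from \<open>F p\<close> to the
  image of that leaf; this distance is at most \<open>D (F q) (F z')\<close>, which is at most
  \<open>A\<close> times the image step at \<open>q\<close>.\<close>

lemma leaf_distance_comparison:
  assumes F: "bij_betw F X X" "weakly_qs A F" "0 \<le> A"
    and leaf: "\<And>x y. x \<in> X \<Longrightarrow> y \<in> X \<Longrightarrow> same_leaf (F x) (F y) \<longleftrightarrow> same_leaf x y"
    and X: "p \<in> X" "p' \<in> X" "q \<in> X" "q' \<in> X"
    and l: "same_leaf p q"
    and le: "D p p' \<le> D q q'"
  shows "D (F p) (F p') \<le> A\<^sup>2 * D (F q) (F q')"
proof -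
  have 1: "1 < r" "0 < ns 1" using r2 ns_pos by (auto simp: Suc_le_eq)
  define \<rho> where "\<rho> = D q q'"
  define z where "z = translate 1 0 (\<rho> powr s 1) p"
  define z' where "z' = translate 1 0 (\<rho> powr s 1) q"
  have zX: "z \<in> X" "z' \<in> X" using X 1 by (auto simp: z_def z'_def translate_in_X)
  have zz': "same_leaf z z'" using l by (auto simp: same_leaf_def z_def z'_def translate_def)
  have FX: "F x \<in> X" if "x \<in> X" for x using F(1) that bij_betwE by blast
  \<comment> \<open>\<open>w\<close> is the preimage of a point nearest to \<open>F p\<close> on the
    leaf of \<open>F z\<close>; that \<open>w\<close> lies on the leaf of \<open>z\<close> uses the
    backward direction of \<open>leaf\<close>.\<close>
  have "(F z)(0 := F p 0) \<in> X" using FX[OF X(1)] FX[OF zX(1)] by (auto simp: pspace_def)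
  then obtain w where w: "w \<in> X" "F w = (F z)(0 := F p 0)"
    using F(1) by (metis bij_betw_imp_surj_on imageE)
  have "same_leaf (F w) (F z)" using w by (auto simp: same_leaf_def)
  then have wz: "same_leaf w z" using leaf w zX by blast
  have "\<rho> \<le> D p w"
  \<comment> \<open>Block 1 alone separates \<open>p\<close> from every point of the leaf of
    \<open>z\<close> by \<rho>, wherever block 0 of \<open>w\<close> may be.\<close>
  proof (rule D_geI[OF 1(1)])
    have "\<rho> powr s 1 = \<bar>p 1 0 - w 1 0\<bar>"
      using wz by (auto simp: same_leaf_def z_def translate_def)
    then show "\<rho> powr s 1 \<le> blockdist ns 1 p w"
      using coord_le_blockdist[of 0 1 p w] 1 by simp
  qed (simp add: \<rho>_def)
  then have "D (F p) (F p') \<le> A * D (F p) (F w)"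
    using le X w F(2) by (intro weakly_qsD) (auto simp: \<rho>_def)
  moreover have "D (F p) (F w) \<le> D (F q) (F z')"
    unfolding w(2) using leaf X zX l zz' by (intro D_fun_upd_le) auto
  moreover have "D (F q) (F z') \<le> A * D (F q) (F q')"
    using F(2) X zX 1 D_translate[of 1 0 \<rho> q] by (intro weakly_qsD) (auto simp: \<rho>_def z'_def)
  ultimately have "D (F p) (F p') \<le> A * (A * D (F q) (F q'))"
    using F(3) by (meson mult_left_mono order_trans)
  then show ?thesis by (simp add: power2_eq_square)
qed

text \<open>Cut the source segment at \<open>p\<close> into \<open>m\<close> pieces and the image
  segment at \<open>F q\<close> into \<open>l\<close> pieces, with \<open>a / m \<le> b / l\<close>,
  and compare one piece of each. Rationals \<open>m / l\<close> approaching \<open>a / b\<close>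
  from above give the ratio bound.\<close>

lemma leaf_ratio_comparison:
  assumes F: "bij_betw F X X" "weakly_qs A F" "0 \<le> A"
    and leaf: "\<And>x y. x \<in> X \<Longrightarrow> y \<in> X \<Longrightarrow> same_leaf (F x) (F y) \<longleftrightarrow> same_leaf x y"
    and X: "p \<in> X" "p' \<in> X" "q \<in> X" "q' \<in> X"
    and l: "same_leaf p p'" "same_leaf p q" "same_leaf q q'"
    and ne: "p \<noteq> p'" "q \<noteq> q'"
  shows "D (F p) (F p') / D p p' \<le> A\<^sup>2 * (D (F q) (F q') / D q q')"
proof -
  define G where "G = inv_into X F"
  have GF: "G (F x) = x" if "x \<in> X" for x
    using F(1) that by (simp add: G_def bij_betw_inv_into_left)
  have FG: "F (G x) = x" and GX: "G x \<in> X" if "x \<in> X" for x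
    using F(1) that by (auto simp: G_def bij_betw_inv_into_right bij_betw_def inv_into_into)
  have FX: "F x \<in> X" if "x \<in> X" for x using F(1) that bij_betwE by blast
  define a b c where "a = D p p'" and "b = D q q'" and "c = A\<^sup>2 * D (F q) (F q')"
  have ab: "0 < a" "0 < b" using X ne by (auto simp: a_def b_def D_pos_iff)
  have key: "D (F p) (F p') \<le> c * (m / l)" if lm: "0 < l" "0 < m" "a / b \<le> real m / real l" for l m :: nat
  proof -
    obtain u v where uv: "u \<in> X" "v \<in> X" "same_leaf p u" "same_leaf p v" "D u v = a / m"
      "D (F p) (F p') / m \<le> D (F u) (F v)"
      using subdivide_leaf[OF X(1,2) l(1) lm(2), of F] unfolding a_def by metis
    \<comment> \<open>Subdividing in the image with \<open>G\<close> yields a piece of exact image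
      length whose preimage has length at least \<open>b / l\<close>.\<close>
    obtain u' v' where uv': "u' \<in> X" "v' \<in> X" "same_leaf (F q) u'" "same_leaf (F q) v'"
      "D u' v' = D (F q) (F q') / l" "D (G (F q)) (G (F q')) / l \<le> D (G u') (G v')"
      using subdivide_leaf[of "F q" "F q'" l G] leaf X l FX lm(1) by metis
    have "same_leaf q (G u')" using uv' leaf[of q "G u'"] X GX FG by metis
    then have "same_leaf u (G u')" using l uv(3) same_leaf_trans same_leaf_sym by metis
    moreover have "a / m \<le> b / l" using lm ab by (simp add: field_simps)
    then have "D u v \<le> D (G u') (G v')" using uv uv' GF X by (simp add: b_def)
    ultimately have "D (F u) (F v) \<le> A\<^sup>2 * D (F (G u')) (F (G v'))"
      using leaf_distance_comparison[OF F leaf] uv uv' GX by blast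
    also have "\<dots> = c / l" using uv' FG by (simp add: c_def)
    finally have "D (F p) (F p') / m \<le> c / l" using uv(6) by linarith
    then show ?thesis using lm by (simp add: field_simps)
  qed
  have "D (F p) (F p') \<le> c * (a / b)"
  proof (rule ccontr)
    assume *: "\<not> ?thesis"
    have "0 \<le> c" by (simp add: c_def)
    \<comment> \<open>Positivity of \<open>c\<close> permits division by it; for
      \<open>c = 0\<close> any admissible fraction, such as the rounded-up \<open>a / b\<close> over
      1, already gives a contradiction.\<close>
    moreover have "c \<noteq> 0"
    proof
      assume "c = 0"
      have "a / b \<le> real (nat \<lceil>a / b\<rceil>) / real 1" "0 < nat \<lceil>a / b\<rceil>" using ab by auto
      then have "D (F p) (F p') \<le> 0" using key[of 1 "nat \<lceil>a / b\<rceil>"] \<open>c = 0\<close> by simp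
      then show False using * \<open>c = 0\<close> by simp
    qed
    ultimately have c: "0 < c" by simp
    have "a / b < D (F p) (F p') / c" using * c by (simp add: field_simps)
    then obtain t where t: "t \<in> \<rat>" "a / b < t" "t < D (F p) (F p') / c"
      using Rats_dense_in_real by blast
    moreover have "0 < a / b" using ab by simp
    ultimately have "0 < t" by linarith
    then obtain m l :: nat where ml: "l \<noteq> 0" "t = m / l"
      using Rats_abs_nat_div_natE[OF t(1)] by (metis abs_of_pos)
    then have "0 < m" using \<open>0 < t\<close> by (cases m) auto
    then have "D (F p) (F p') \<le> c * t" using key[of l m] ml t by auto
    then show False using t(3) c by (simp add: field_simps)
  qed
  then show ?thesis using ab unfolding a_def b_def c_def by (simp add: field_simps)
qed

text \<open>With a common centre, replace each endpoint by a horizontal one at equal distance (a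
  factor \<open>A\<close> each) and compare on the leaf (\<open>A\<^sup>2\<close>), in total
  \<open>A ^ 4\<close>. Two arbitrary pairs are linked through the pair \<open>p\<close>,
  \<open>x\<close>.\<close>

lemma ratio_comparison:
  assumes F: "bij_betw F X X" "weakly_qs A F" "0 \<le> A"
    and leaf: "\<And>x y. x \<in> X \<Longrightarrow> y \<in> X \<Longrightarrow> same_leaf (F x) (F y) \<longleftrightarrow> same_leaf x y"
    and X: "p \<in> X" "q \<in> X" "x \<in> X" "y \<in> X"
    and ne: "p \<noteq> q" "x \<noteq> y"
  shows "D (F p) (F q) / D p q \<le> A ^ 8 * (D (F x) (F y) / D x y)"
proof -
  define R where "R u v = D (F u) (F v) / D u v" for u v
  have 0: "0 < r" "0 < ns 0" using r2 ns_pos by (auto simp: Suc_le_eq)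
  have R_commute: "R u v = R v u" for u v by (simp add: R_def D_commute)
  have same_centre: "R u v \<le> A ^ 4 * R u w"
    if "u \<in> X" "v \<in> X" "w \<in> X" "u \<noteq> v" "u \<noteq> w" for u v w
  proof -
    define h where "h t = translate 0 0 t u" for t
    have D_h: "D u (h t) = t" if "0 \<le> t" for t
      using D_translate[of 0 0 t u] 0 that alpha_pos by (simp add: h_def)
    have hX: "h t \<in> X" for t using 0 that by (simp add: h_def translate_in_X)
    have hl: "same_leaf u (h t)" for t by (simp add: h_def same_leaf_def translate_def)
    have pos: "0 < D u v" "0 < D u w" using that by (auto simp: D_pos_iff)
    have "R u v \<le> A * R u (h (D u v))"
      using weakly_qsD[OF F(2), of u v "h (D u v)"] pos that hX D_h
      by (simp add: R_def divide_right_mono)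
    also have "\<dots> \<le> A * (A\<^sup>2 * R u (h (D u w)))"
    proof (rule mult_left_mono[OF _ F(3)])
      show "R u (h (D u v)) \<le> A\<^sup>2 * R u (h (D u w))"
      unfolding R_def using that hX hl pos D_h[of "D u v"] D_h[of "D u w"]
      by (intro leaf_ratio_comparison[OF F leaf]) auto
    qed
    also have "\<dots> = A ^ 3 * R u (h (D u w))" by (simp add: eval_nat_numeral)
    also have "\<dots> \<le> A ^ 3 * (A * R u w)"
    proof (rule mult_left_mono)
      show "R u (h (D u w)) \<le> A * R u w"
      using weakly_qsD[OF F(2), of u "h (D u w)" w] pos that hX D_h
      by (simp add: R_def divide_right_mono)
    qed (use F(3) in simp)
    finally show ?thesis by (simp add: eval_nat_numeral mult_ac)
  qed
  have A8: "A ^ 8 = A ^ 4 * A ^ 4" by simp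
  show ?thesis
  proof (cases "p = x")
    case True
    have "R p q \<le> A ^ 4 * R p y" using same_centre X ne True by auto
    \<comment> \<open>A trivial comparison of the pair with itself, inserted only to reach the
      uniform exponent 8.\<close>
    also have "R p y \<le> A ^ 4 * R p y" using same_centre X ne True by auto
    finally show ?thesis unfolding A8 using True F(3)
      by (simp add: mult_left_mono mult.assoc R_def)
  next
    case False
    have "R p q \<le> A ^ 4 * R p x" using same_centre X ne False by auto
    also have "R p x = R x p" by (rule R_commute)
    also have "R x p \<le> A ^ 4 * R x y" using same_centre X ne False by auto
    finally show ?thesis unfolding A8 using F(3)
      by (simp add: mult_left_mono mult.assoc R_def)
  qed
qed

end

section \<open>Volume and counting\<close>

text \<open>Additivity and monotonicity of the product Lebesgue measure; \<open>sub\<close> puts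
  every box inside the box around \<open>z\<close> with half-widths \<open>H\<close>.\<close>

lemma sum_volume_disjoint_boxes_le:
  fixes c h :: "'g \<Rightarrow> 'i \<Rightarrow> real" and z H :: "'i \<Rightarrow> real"
  assumes "finite I" "finite G"
    and h: "\<And>g i. g \<in> G \<Longrightarrow> i \<in> I \<Longrightarrow> 0 \<le> h g i"
    and H: "\<And>i. i \<in> I \<Longrightarrow> 0 \<le> H i"
    and disj: "disjoint_family_on (\<lambda>g. PiE I (\<lambda>i. {c g i - h g i<..<c g i + h g i})) G"
    and sub: "\<And>g i. g \<in> G \<Longrightarrow> i \<in> I \<Longrightarrow> \<bar>c g i - z i\<bar> + h g i \<le> H i"
  shows "(\<Sum>g\<in>G. \<Prod>i\<in>I. 2 * h g i) \<le> (\<Prod>i\<in>I. 2 * H i)"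
proof -
  interpret product_sigma_finite "\<lambda>_::'i. lborel :: real measure" ..
  let ?M = "PiM I (\<lambda>_. lborel :: real measure)"
  define B where "B g = PiE I (\<lambda>i. {c g i - h g i<..<c g i + h g i})" for g
  define Z where "Z = PiE I (\<lambda>i. {z i - H i..z i + H i})"
  have B: "B g \<in> sets ?M" for g unfolding B_def using assms(1) by (intro sets_PiM_I_finite) auto
  have Z: "Z \<in> sets ?M" unfolding Z_def using assms(1) by (intro sets_PiM_I_finite) auto
  have eB: "emeasure ?M (B g) = ennreal (\<Prod>i\<in>I. 2 * h g i)" if "g \<in> G" for g
  proof -
    have "emeasure ?M (B g) = (\<Prod>i\<in>I. emeasure lborel {c g i - h g i<..<c g i + h g i})"
      unfolding B_def using assms(1) by (intro emeasure_PiM) auto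
    also have "\<dots> = (\<Prod>i\<in>I. ennreal (2 * h g i))"
      using h[OF that] by (intro prod.cong) auto
    also have "\<dots> = ennreal (\<Prod>i\<in>I. 2 * h g i)" using h[OF that] by (intro prod_ennreal) auto
    finally show ?thesis .
  qed
  have eZ: "emeasure ?M Z = ennreal (\<Prod>i\<in>I. 2 * H i)"
  proof -
    have "emeasure ?M Z = (\<Prod>i\<in>I. emeasure lborel {z i - H i..z i + H i})"
      unfolding Z_def using assms(1) by (intro emeasure_PiM) auto
    also have "\<dots> = (\<Prod>i\<in>I. ennreal (2 * H i))"
      using H by (intro prod.cong) auto
    also have "\<dots> = ennreal (\<Prod>i\<in>I. 2 * H i)" using H by (intro prod_ennreal) auto
    finally show ?thesis .
  qed
  have "ennreal (\<Sum>g\<in>G. \<Prod>i\<in>I. 2 * h g i) = (\<Sum>g\<in>G. emeasure ?M (B g))"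
    using h by (simp add: eB sum_ennreal prod_nonneg)
  also have "\<dots> = emeasure ?M (\<Union>g\<in>G. B g)"
    using disj B assms(2) unfolding B_def by (intro sum_emeasure) auto
  also have "\<dots> \<le> emeasure ?M Z"
  proof (rule emeasure_mono[OF _ Z], safe)
    fix g u assume g: "g \<in> G" "u \<in> B g"
    have "u i \<in> {z i - H i..z i + H i}" if "i \<in> I" for i
      using g that sub[OF g(1) that] unfolding B_def
      by (fastforce dest!: PiE_mem[of u I _ i] simp: abs_le_iff)
    then show "u \<in> Z" using g unfolding B_def Z_def by (auto simp: PiE_def)
  qed
  finally show ?thesis unfolding eZ using H by (simp add: ennreal_le_iff prod_nonneg)
qed

text \<open>\<open>P\<close> stands for the number of columns. A suitable \<tau> absorbs half of
  \<open>a * P\<close>, leaving \<open>m powr (Q - 1)\<close> bounded by a constant times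
  \<open>m powr ((Q - s) / s)\<close>. The exponents differ by \<open>Q * (1 - 1 / s) > 0\<close>,
  which is impossible for large \<open>m\<close>.\<close>

lemma counting_contradiction:
  fixes a c V s Q :: real
  assumes pos: "0 < a" "0 < c" "1 < s" "s \<le> Q"
    and ex: "\<And>m::nat. (0::nat) < m \<Longrightarrow> \<exists>P. c * real m powr (Q - 1) \<le> P \<and>
      (\<forall>\<tau>>0. a * P \<le> real m * P * \<tau> powr s + V * \<tau> powr (s - Q))"
  shows False
proof -
  define e where "e = Q - 1 - (Q - s) / s"
  have "e = Q * (1 - 1 / s)" using pos by (simp add: e_def field_simps)
  then have e: "0 < e" using pos by simp
  define W where "W = V * (a / 2) powr ((s - Q) / s) / (c * a / 2)"
  have bound: "m powr e \<le> W" if m: "0 < m" for m :: nat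
  proof -
    obtain P where P: "c * m powr (Q - 1) \<le> P"
      "\<And>\<tau>. 0 < \<tau> \<Longrightarrow> a * P \<le> real m * P * \<tau> powr s + V * \<tau> powr (s - Q)"
      using ex[OF m] by blast
    \<comment> \<open>Solves \<open>m * \<tau> powr s = a / 2\<close>.\<close>
    define \<tau> where "\<tau> = (a / (2 * m)) powr (1 / s)"
    have \<tau>: "0 < \<tau>" "\<tau> powr s = a / (2 * m)" "\<tau> powr (s - Q) = (a / (2 * m)) powr ((s - Q) / s)"
      using pos m by (auto simp: \<tau>_def powr_powr)
    have "a / (2 * m) = (a / 2) * (1 / m)" by simp
    then have "(a / (2 * m)) powr ((s - Q) / s) = (a / 2) powr ((s - Q) / s) * (1 / m) powr ((s - Q) / s)"
      using pos m by (simp only: powr_mult)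
    also have "(1 / real m) powr ((s - Q) / s) = real m powr ((Q - s) / s)"
      using m by (simp add: powr_divide powr_minus_divide[symmetric] minus_divide_left)
    finally have "a * P \<le> a * P / 2 + V * ((a / 2) powr ((s - Q) / s) * m powr ((Q - s) / s))"
      using P(2)[OF \<tau>(1)] \<tau> m by (simp add: mult.commute)
    moreover have "a * (c * m powr (Q - 1)) \<le> a * P" using P(1) pos by simp
    ultimately have "c * a / 2 * m powr (Q - 1) \<le> V * (a / 2) powr ((s - Q) / s) * m powr ((Q - s) / s)"
      by (simp add: mult_ac)
    then have "m powr (Q - 1) \<le> W * m powr ((Q - s) / s)"
      using pos unfolding W_def by (simp add: field_simps)
    then show ?thesis using m unfolding e_def powr_diff[of _ "Q - 1"]
      by (simp add: divide_le_eq)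
  qed
  define m where "m = nat \<lceil>(\<bar>W\<bar> + 1) powr (1 / e)\<rceil>"
  have m: "(\<bar>W\<bar> + 1) powr (1 / e) \<le> m" unfolding m_def by linarith
  have "0 < (\<bar>W\<bar> + 1) powr (1 / e)" by simp
  then have m0: "0 < m" using m by (metis of_nat_0_less_iff less_le_trans)
  have "\<bar>W\<bar> + 1 = ((\<bar>W\<bar> + 1) powr (1 / e)) powr e" using e by (simp add: powr_powr)
  also have "\<dots> \<le> m powr e" using m e by (intro powr_mono2) auto
  finally show False using bound[OF m0] by linarith
qed

context block_space begin

text \<open>The homogeneous dimension: \<open>s i\<close> counts once per coordinate of block
  \<open>i\<close>, so \<open>D\<close>-balls of radius \<open>t\<close> have volume proportional to
  \<open>t powr Q\<close>.\<close>

abbreviation Q where "Q \<equiv> \<Sum>(i, j)\<in>I. s i"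

text \<open>The box around \<open>f g\<close> with half-widths \<open>t g powr s i / ns i\<close>
  lies in the open \<open>D\<close>-ball of radius \<open>t g\<close>, because a Euclidean norm is
  at most the sum of the coordinates' absolute values. Separation makes the boxes disjoint, and all
  lie in one box around \<open>b\<close>.\<close>

lemma packing_bound:
  fixes f :: "'g \<Rightarrow> nat \<Rightarrow> nat \<Rightarrow> real" and t :: "'g \<Rightarrow> real"
  assumes "finite G"
    and t: "\<And>g. g \<in> G \<Longrightarrow> 0 < t g" "\<And>g. g \<in> G \<Longrightarrow> t g \<le> R"
    and R: "\<And>g. g \<in> G \<Longrightarrow> D (f g) b \<le> R"
    and sep: "\<And>g g'. g \<in> G \<Longrightarrow> g' \<in> G \<Longrightarrow> g \<noteq> g' \<Longrightarrow> t g + t g' \<le> D (f g) (f g')"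
  shows "(\<Sum>g\<in>G. t g powr Q) \<le> (\<Prod>(i, j)\<in>I. 2 * ns i * R powr s i)"
proof -
  define h where "h = (\<lambda>g (i, j::nat). t g powr s i / ns i)"
  define c where "c = (\<lambda>g (i, j). f g i j)"
  define H where "H = (\<lambda>(i, j::nat). 2 * R powr s i)"
  have fI: "finite I" by auto
  have nsI: "1 \<le> real (ns i)" if "i < r" for i using ns_pos that by (simp add: Suc_le_eq)
  have "disjoint_family_on (\<lambda>g. PiE I (\<lambda>i. {c g i - h g i<..<c g i + h g i})) G"
  proof (unfold disjoint_family_on_def, intro ballI impI, rule ccontr)
    fix g g' assume g: "g \<in> G" "g' \<in> G" "g \<noteq> g'"
      and "PiE I (\<lambda>i. {c g i - h g i<..<c g i + h g i}) \<inter>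
        PiE I (\<lambda>i. {c g' i - h g' i<..<c g' i + h g' i}) \<noteq> {}"
    then obtain u where u: "u \<in> PiE I (\<lambda>i. {c g i - h g i<..<c g i + h g i})"
      "u \<in> PiE I (\<lambda>i. {c g' i - h g' i<..<c g' i + h g' i})" by blast
    \<comment> \<open>\<open>D\<close> reads only coordinates indexed by \<open>I\<close>, so the
      values of \<open>u\<close> elsewhere do not affect this distance.\<close>
    have near: "D (f k) (curry u) < t k"
      if k: "k \<in> G" "u \<in> PiE I (\<lambda>i. {c k i - h k i<..<c k i + h k i})" for k
    proof (rule ccontr)
      assume "\<not> ?thesis"
      then have tD: "t k \<le> D (f k) (curry u)" by simp
      have "blockdist ns i (f k) (curry u) < t k powr s i" if i: "i < r" for i
      proof -
        have "blockdist ns i (f k) (curry u) \<le> (\<Sum>j<ns i. \<bar>f k i j - u (i, j)\<bar>)"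
          using blockdist_le_sum[of i "f k" "curry u"] by simp
        also have "\<dots> < (\<Sum>j<ns i. t k powr s i / ns i)"
        proof (rule sum_strict_mono)
          show "\<bar>f k i j - u (i, j)\<bar> < t k powr s i / ns i" if "j \<in> {..<ns i}" for j
            using PiE_mem[OF k(2), of "(i, j)"] that i by (auto simp: c_def h_def)
        qed (use nsI[OF i] in \<open>auto simp: lessThan_empty_iff\<close>)
        also have "\<dots> = t k powr s i" using nsI[OF i] by simp
        finally show ?thesis .
      qed
      \<comment> \<open>A block attaining the maximum turns the strict blockwise bounds into a
        strict bound on \<open>D\<close>.\<close>
      moreover obtain i where "i < r" "D (f k) (curry u) powr s i \<le> blockdist ns i (f k) (curry u)"
      proof -
        have "D (f k) (curry u) \<in> (\<lambda>i. blockdist ns i (f k) (curry u) powr (\<alpha> 0 / \<alpha> i)) ` {..<r}"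
          unfolding Dmet_def using r2 by (intro Max_in) (auto simp: lessThan_empty_iff)
        then obtain i where i: "i < r" "D (f k) (curry u) = blockdist ns i (f k) (curry u) powr (\<alpha> 0 / \<alpha> i)"
          by auto
        have "0 < s i" using s_ge_1[OF i(1)] by linarith
        then have "D (f k) (curry u) powr s i = blockdist ns i (f k) (curry u)"
          using alpha_pos unfolding i(2) by (auto simp: powr_powr zero_less_divide_iff)
        then show thesis using that i(1) by simp
      qed
      ultimately have "D (f k) (curry u) powr s i < t k powr s i" "0 < s i"
        using s_ge_1[of i] by (auto intro: le_less_trans)
      then show False using tD t(1)[OF k(1)] powr_mono2[of "s i" "t k" "D (f k) (curry u)"] by linarith
    qed
    show False
      using near[OF g(1) u(1)] near[OF g(2) u(2)] sep[OF g] D_triangle[of "f g" "f g'" "curry u"]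
        D_commute[of "f g'" "curry u"] by linarith
  qed
  moreover have "\<bar>c g x - case_prod b x\<bar> + h g x \<le> H x" if g: "g \<in> G" and x: "x \<in> I" for g x
  proof -
    obtain i j where ij: "x = (i, j)" "i < r" "j < ns i" using x by auto
    have "\<bar>f g i j - b i j\<bar> \<le> R powr s i"
      using coord_le_D[OF ij(2,3), of "f g" b] R[OF g] s_ge_1[OF ij(2)]
        powr_mono2[of "s i" "D (f g) b" R] by simp
    moreover have "t g powr s i / ns i \<le> t g powr s i"
      using nsI[OF ij(2)] by (simp add: divide_le_eq mult_le_cancel_left1)
    moreover have "t g powr s i \<le> R powr s i"
      using t[OF g] s_ge_1[OF ij(2)] by (intro powr_mono2) auto
    ultimately show ?thesis by (simp add: ij c_def h_def H_def)
  qed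
  ultimately have "(\<Sum>g\<in>G. \<Prod>x\<in>I. 2 * h g x) \<le> (\<Prod>x\<in>I. 2 * H x)"
    by (intro sum_volume_disjoint_boxes_le[where c=c and z="case_prod b"])
      (use assms(1) fI in \<open>auto simp: h_def H_def\<close>)
  moreover have "(\<Prod>x\<in>I. 2 * h g x) = (\<Prod>(i, j)\<in>I. 2 / ns i) * t g powr Q" if "g \<in> G" for g
    using t(1)[OF that] fI
    by (subst powr_sum) (auto simp: h_def prod.distrib[symmetric] case_prod_beta intro!: prod.cong)
  \<comment> \<open>The factor \<open>2 / ns i\<close> is split off on both sides so that it
    cancels.\<close>
  moreover have "(\<Prod>x\<in>I. 2 * H x) = (\<Prod>(i, j)\<in>I. 2 / ns i) * (\<Prod>(i, j)\<in>I. 2 * ns i * R powr s i)"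
    unfolding prod.distrib[symmetric] case_prod_beta H_def
    by (intro prod.cong) (use ns_pos in \<open>auto simp: Suc_le_eq\<close>)
  moreover have "0 < (\<Prod>(i, j)\<in>I. 2 / real (ns i))"
    by (intro prod_pos) (use nsI in \<open>force simp: Suc_le_eq\<close>)
  ultimately show ?thesis
    by (simp add: sum_distrib_left[symmetric])
qed


section \<open>Leaves go to leaves\<close>

text \<open>If coordinate \<open>(i, j)\<close> of the image changes, the packing bound on
  \<open>d powr Q\<close> and the lower bound on \<open>d powr s i\<close> in each column feed
  \<open>counting_contradiction\<close>.\<close>

lemma leaf_coordinate_step:
  assumes F: "bij_betw F X X" "weakly_qs A F" "1 \<le> A" "dcontinuous_on D X D F"
    and p: "p \<in> X" and L: "0 < L" and j0: "j0 < ns 0"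
    and ij: "0 < i" "i < r" "j < ns i"
  shows "F (translate 0 j0 L p) i j = F p i j"
proof (rule ccontr)
  define q where "q = translate 0 j0 L p"
  \<comment> \<open>A third of the jump: errors up to \<open>a\<close> at both ends still leave a
    change of at least \<open>a\<close>.\<close>
  define a where "a = \<bar>F q i j - F p i j\<bar> / 3"
  assume "\<not> ?thesis"
  then have a: "0 < a" by (simp add: a_def q_def)
  have r0: "0 < r" "0 < ns 0" using r2 j0 by auto
  have qX: "q \<in> X" using p r0 j0 by (simp add: q_def translate_in_X)
  have FX: "F x \<in> X" if "x \<in> X" for x using F(1) that bij_betwE by blast
  have si: "1 < s i" using ij s_gt_1 by simp
  define I' where "I' = I - {(0, j0)}"
  have fI: "finite I" "finite I'" by (auto simp: I'_def)
  have Q_split: "Q = 1 + (\<Sum>(i, j)\<in>I'. s i)"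
    unfolding I'_def using r0 j0 alpha_pos by (subst sum.remove[of _ "(0, j0)"]) auto
  have s_le_Q: "s i \<le> Q"
    using member_le_sum[of "(i, j)" I "\<lambda>(i, j). s i"] ij s_ge_1 by (force intro: order_trans[OF zero_le_one])

  \<comment> \<open>An image error below \<open>e\<close> in \<open>D\<close> moves coordinate
    \<open>(i, j)\<close> by at most \<open>a\<close>.\<close>
  define e where "e = a powr (1 / s i)"
  have e: "0 < e" "e powr s i = a" using a si by (auto simp: e_def powr_powr)
  obtain \<delta>1 where \<delta>1: "0 < \<delta>1" "\<And>y. y \<in> X \<Longrightarrow> D p y < \<delta>1 \<Longrightarrow> D (F p) (F y) < e"
    using F(4) p e(1) unfolding dcontinuous_on_def by blast
  obtain \<delta>2 where \<delta>2: "0 < \<delta>2" "\<And>y. y \<in> X \<Longrightarrow> D q y < \<delta>2 \<Longrightarrow> D (F q) (F y) < e"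
    using F(4) qX e(1) unfolding dcontinuous_on_def by blast
  define \<delta> where "\<delta> = min \<delta>1 \<delta>2"
  have \<delta>: "0 < \<delta>" using \<delta>1 \<delta>2 by (simp add: \<delta>_def)
  have far: "a \<le> \<bar>F y i j - F x i j\<bar>" if xy: "x \<in> X" "y \<in> X" "D p x < \<delta>" "D q y < \<delta>" for x y
  proof -
    have "D (F p) (F x) powr s i \<le> a" "D (F q) (F y) powr s i \<le> a"
      unfolding e(2)[symmetric] using \<delta>1(2)[OF xy(1)] \<delta>2(2)[OF xy(2)] xy si
      by (auto intro!: powr_mono2 simp: \<delta>_def)
    then have "\<bar>F p i j - F x i j\<bar> \<le> a" "\<bar>F q i j - F y i j\<bar> \<le> a"
      using coord_le_D[OF ij(2,3)] order_trans by blast+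
    then show ?thesis unfolding a_def by (simp add: abs_if split: if_splits)
  qed

  \<comment> \<open>Width of the grid in each coordinate of block \<open>i\<close>:
    \<open>ns i\<close> of them add up to \<open>(\<delta> / 2) powr s i\<close>, which keeps the
    grid near the segment.\<close>
  define \<theta> where "\<theta> i = (\<delta> / 2) powr s i / ns i" for i
  have \<theta>: "0 < \<theta> i" if "i < r" for i using ns_pos \<delta> that by (auto simp: \<theta>_def Suc_le_eq)
  \<comment> \<open>Weak quasisymmetry keeps the images of points within \<open>L + \<delta>\<close>
    of \<open>p\<close> within \<open>R / 2\<close> of \<open>F p\<close>; the factor 2 makes every
    image edge at most \<open>R\<close>.\<close>
  define R where "R = 2 * A * D (F p) (F (translate 0 0 (L + \<delta>) p))"
  have R: "D (F x) (F p) \<le> R / 2" if "x \<in> X" "D p x \<le> L + \<delta>" for x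
    unfolding R_def using weakly_qsD[OF F(2), of p x "translate 0 0 (L + \<delta>) p"] that p r0 L \<delta>
      D_translate[of 0 0 "L + \<delta>" p] alpha_pos
    by (simp add: translate_in_X D_commute[of "F x"])
  \<comment> \<open>\<open>V\<close> and \<open>c\<close> are independent of the mesh:
    \<open>V\<close> bounds the sum of \<open>d powr Q\<close>, and
    \<open>c * m powr (Q - 1)\<close> bounds the number of columns from below.\<close>
  define V where "V = (2 * A) powr Q * (\<Prod>(i, j)\<in>I. 2 * ns i * R powr s i)"
  define c where "c = (\<Prod>(i, j)\<in>I'. \<theta> i / L powr s i)"
  have c: "0 < c" unfolding c_def by (rule prod_pos) (use \<theta> L in \<open>auto simp: I'_def\<close>)

  have "\<exists>P. c * real m powr (Q - 1) \<le> P \<and>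
      (\<forall>\<tau>>0. a * P \<le> real m * P * \<tau> powr s i + V * \<tau> powr (s i - Q))" if m: "0 < m" for m :: nat
  proof -
    define \<epsilon> where "\<epsilon> = L / m"
    have \<epsilon>: "0 < \<epsilon>" "m * \<epsilon> = L" using L m by (auto simp: \<epsilon>_def)
    \<comment> \<open>Rounding up serves both sides: an index below \<open>N i\<close> still gives
      an offset of at most \<open>\<theta> i\<close>, and \<open>N i\<close> is at least the
      quotient.\<close>
    define N where "N i = nat \<lceil>\<theta> i / \<epsilon> powr s i\<rceil>" for i
    \<comment> \<open>\<open>K\<close> selects the column and \<open>k\<close> the position on it;
      \<open>k\<close> overwrites entry \<open>(0, j0)\<close>, which \<open>K\<close> in
      \<open>C\<close> leaves unspecified.\<close>
    define g where "g K k = (\<lambda>i j. if (i, j) \<in> I then p i j + real ((K((0, j0) := k)) (i, j)) * \<epsilon> powr s i else 0)"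
      for K :: "nat \<times> nat \<Rightarrow> nat" and k
    have gX: "g K k \<in> X" for K k by (auto simp: g_def pspace_def)
    have g_zero: "g (\<lambda>_. 0) k = translate 0 j0 (k * \<epsilon>) p" for k
      using p \<epsilon> j0 r0 alpha_pos by (intro ext) (auto simp: g_def translate_def pspace_def not_less)
    have g_Suc: "g K (Suc k) = translate 0 j0 \<epsilon> (g K k)" for K k
      using \<epsilon> j0 r0 alpha_pos by (intro ext) (auto simp: g_def translate_def algebra_simps)
    have D_Suc: "D (g K k) (g K (Suc k)) = \<epsilon>" for K k
      unfolding g_Suc using D_translate[of 0 j0 \<epsilon> "g K k"] r0 j0 \<epsilon> alpha_pos by simp
    define C where "C = PiE I' (\<lambda>(i, j). {..<N i})"
    have fC: "finite C" unfolding C_def using fI(2) by (intro finite_PiE) auto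
    have g_near: "D (g (\<lambda>_. 0) k) (g K k) < \<delta>" if K: "K \<in> C" for K k
    proof -
      have "D (g (\<lambda>_. 0) k) (g K k) \<le> \<delta> / 2"
      proof (subst D_le_iff, use \<delta> in simp, safe)
        fix i assume i: "i < r"
        have "blockdist ns i (g (\<lambda>_. 0) k) (g K k) \<le> (\<Sum>j<ns i. \<bar>g (\<lambda>_. 0) k i j - g K k i j\<bar>)"
          by (rule blockdist_le_sum)
        also have "\<dots> \<le> (\<Sum>j<ns i. \<theta> i)"
        proof (rule sum_mono)
          fix j assume j: "j \<in> {..<ns i}"
          show "\<bar>g (\<lambda>_. 0) k i j - g K k i j\<bar> \<le> \<theta> i"
          proof (cases "(i, j) = (0, j0)")
            case False
            then have "(i, j) \<in> I'" using i j by (simp add: I'_def)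
            then have "K (i, j) < N i" using K PiE_mem[of K I' _ "(i, j)"] unfolding C_def by fastforce
            then have "real (K (i, j)) \<le> \<theta> i / \<epsilon> powr s i" unfolding N_def by linarith
            then show ?thesis using False i j \<epsilon> by (auto simp: g_def field_simps)
          qed (use \<theta>[OF i] in \<open>auto simp: g_def\<close>)
        qed
        also have "\<dots> = (\<delta> / 2) powr s i" using ns_pos i by (auto simp: \<theta>_def Suc_le_eq)
        finally show "blockdist ns i (g (\<lambda>_. 0) k) (g K k) \<le> (\<delta> / 2) powr s i" .
      qed
      then show ?thesis using \<delta> by linarith
    qed
    define d where "d = (\<lambda>(K, k). D (F (g K k)) (F (g K (Suc k))))"
    define G where "G = C \<times> {..<m}"
    have fG: "finite G" by (simp add: G_def fC)
    have d_pos: "0 < d x" for x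
    proof (cases x)
      case (Pair K k)
      have "g K k \<noteq> g K (Suc k)" using D_Suc[of K k] \<epsilon> by auto
      then have "F (g K k) \<noteq> F (g K (Suc k))" using F(1) gX by (metis bij_betw_imp_inj_on inj_onD)
      then show ?thesis using gX FX Pair by (simp add: d_def D_pos_iff)
    qed
    have bdd: "D (F (g K k)) (F p) \<le> R / 2" if "K \<in> C" "k \<le> m" for K k
    proof (rule R[OF gX])
      have "D p (g (\<lambda>_. 0) k) = k * \<epsilon>"
        unfolding g_zero using D_translate[of 0 j0 "k * \<epsilon>" p] r0 j0 \<epsilon> alpha_pos by simp
      also have "\<dots> \<le> L" using that \<epsilon> by (metis less_imp_le mult_right_mono of_nat_le_iff)
      finally show "D p (g K k) \<le> L + \<delta>"
        using D_triangle[of p "g K k" "g (\<lambda>_. 0) k"] g_near[OF that(1), of k] by linarith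
    qed
    \<comment> \<open>Distinct grid points are at least \<epsilon> apart, which is the edge length,
      so weak quasisymmetry applies at the vertex \<open>g K k\<close>.\<close>
    have sep: "d (K, k) \<le> A * D (F (g K k)) (F (g K' k'))"
      if K: "K \<in> C" "K' \<in> C" "(K, k) \<noteq> (K', k')" for K K' k k'
    proof -
      obtain x where x: "x \<in> I" "(K((0, j0) := k)) x \<noteq> (K'((0, j0) := k')) x"
      proof (cases "k = k'")
        case True
        then have "K \<noteq> K'" using K by simp
        then obtain x where "x \<in> I'" "K x \<noteq> K' x" using K unfolding C_def by (meson PiE_ext)
        then show thesis by (intro that[of x]) (auto simp: I'_def)
      qed (use that[of "(0, j0)"] r0 j0 in auto)
      obtain i j where ij: "x = (i, j)" "i < r" "j < ns i" using x by auto
      let ?n = "(K((0, j0) := k)) x" and ?n' = "(K'((0, j0) := k')) x"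
      have "\<epsilon> \<le> D (g K k) (g K' k')"
      proof (rule D_geI[OF ij(2)])
        have "1 \<le> \<bar>real ?n - real ?n'\<bar>" using x(2) by linarith
        then have "\<epsilon> powr s i \<le> \<bar>real ?n - real ?n'\<bar> * \<epsilon> powr s i"
          by (simp add: mult_le_cancel_right1)
        also have "\<dots> = \<bar>(real ?n - real ?n') * \<epsilon> powr s i\<bar>" by (simp add: abs_mult)
        also have "\<dots> = \<bar>g K k i j - g K' k' i j\<bar>"
          using ij by (simp add: g_def algebra_simps)
        also have "\<dots> \<le> blockdist ns i (g K k) (g K' k')" by (rule coord_le_blockdist[OF ij(3)])
        finally show "\<epsilon> powr s i \<le> blockdist ns i (g K k) (g K' k')" .
      qed (use \<epsilon> in simp)
      then show ?thesis unfolding d_def using D_Suc[of K k] gX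
        by (auto intro!: weakly_qsD[OF F(2)])
    qed

    have "(\<Sum>x\<in>G. (d x / (2 * A)) powr Q) \<le> (\<Prod>(i, j)\<in>I. 2 * ns i * R powr s i)"
    proof (rule packing_bound[where f="\<lambda>(K, k). F (g K k)" and b="F p"])
      fix x assume x: "x \<in> G"
      obtain K k where Kk: "x = (K, k)" "K \<in> C" "k < m" using x by (auto simp: G_def)
      have b: "D (F (g K k)) (F p) \<le> R / 2" "D (F (g K (Suc k))) (F p) \<le> R / 2"
        using bdd Kk by auto
      show "0 < d x / (2 * A)" using d_pos F(3) by simp
      have "d x \<le> R" using b D_triangle[of "F (g K k)" "F (g K (Suc k))" "F p"]
        by (simp add: d_def Kk D_commute[of "F p"])
      moreover have "d x / (2 * A) \<le> d x" using d_pos[of x] F(3) by (simp add: divide_le_eq)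
      ultimately show "d x / (2 * A) \<le> R" by linarith
      have "0 \<le> R" using b(1) D_nonneg[of "F (g K k)" "F p"] by linarith
      then show "D (case x of (K, k) \<Rightarrow> F (g K k)) (F p) \<le> R" using b Kk by simp
    next
      fix x y assume xy: "x \<in> G" "y \<in> G" "x \<noteq> y"
      obtain K k K' k' where Kk: "x = (K, k)" "y = (K', k')" "K \<in> C" "K' \<in> C" using xy by (auto simp: G_def)
      show "d x / (2 * A) + d y / (2 * A) \<le> D (case x of (K, k) \<Rightarrow> F (g K k)) (case y of (K, k) \<Rightarrow> F (g K k))"
      proof -
        have "d x \<le> A * D (F (g K k)) (F (g K' k'))" "d y \<le> A * D (F (g K k)) (F (g K' k'))"
          using sep[of K K' k k'] sep[of K' K k' k] Kk xy D_commute[of "F (g K k)" "F (g K' k')"] by auto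
        then show ?thesis using Kk F(3) by (simp add: field_simps)
      qed
    qed (rule fG)
    moreover have "(\<Sum>x\<in>G. d x powr Q) = (2 * A) powr Q * (\<Sum>x\<in>G. (d x / (2 * A)) powr Q)"
      unfolding sum_distrib_left using d_pos F(3)
      by (intro sum.cong) (auto simp: powr_mult[symmetric] less_imp_le)
    ultimately have dQ: "(\<Sum>x\<in>G. d x powr Q) \<le> V" unfolding V_def by (simp add: mult_left_mono)

    define P where "P = real (card C)"
    have column: "a \<le> (\<Sum>k<m. d (K, k) powr s i)" if K: "K \<in> C" for K
    proof -
      have "a \<le> \<bar>F (g K m) i j - F (g K 0) i j\<bar>"
        using g_near[OF K, of 0] g_near[OF K, of m] gX \<epsilon>(2) unfolding g_zero
        by (intro far) (auto simp: q_def translate_def)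
      also have "\<dots> = \<bar>\<Sum>k<m. F (g K (Suc k)) i j - F (g K k) i j\<bar>"
        by (subst sum_lessThan_telescope[where f="\<lambda>k. F (g K k) i j"]) simp
      also have "\<dots> \<le> (\<Sum>k<m. \<bar>F (g K (Suc k)) i j - F (g K k) i j\<bar>)" by (rule sum_abs)
      also have "\<dots> \<le> (\<Sum>k<m. d (K, k) powr s i)"
        unfolding d_def prod.case by (subst D_commute) (intro sum_mono coord_le_D ij)
      finally show ?thesis .
    qed
    have "a * P \<le> real m * P * \<tau> powr s i + V * \<tau> powr (s i - Q)" if \<tau>: "0 < \<tau>" for \<tau>
    proof -
      have "a * P = (\<Sum>K\<in>C. a)" by (simp add: P_def)
      also have "\<dots> \<le> (\<Sum>K\<in>C. \<Sum>k<m. d (K, k) powr s i)" by (intro sum_mono column)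
      also have "\<dots> = (\<Sum>x\<in>G. d x powr s i)" unfolding G_def by (simp add: sum.cartesian_product)
      \<comment> \<open>Short edges give at most \<open>\<tau> powr s i\<close>; on long ones
        \<open>d powr (s i - Q)\<close> is at most \<open>\<tau> powr (s i - Q)\<close>, since
        \<open>s i \<le> Q\<close>.\<close>
      also have "\<dots> \<le> (\<Sum>x\<in>G. \<tau> powr s i + d x powr Q * \<tau> powr (s i - Q))"
      proof (rule sum_mono)
        fix x
        show "d x powr s i \<le> \<tau> powr s i + d x powr Q * \<tau> powr (s i - Q)"
        proof (cases "d x \<le> \<tau>")
          case True
          then have "d x powr s i \<le> \<tau> powr s i" using d_pos[of x] si by (intro powr_mono2) auto
          moreover have "0 \<le> d x powr Q * \<tau> powr (s i - Q)" by simp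
          ultimately show ?thesis by linarith
        next
          case False
          have "d x powr s i = d x powr Q * d x powr (s i - Q)" by (simp add: powr_add[symmetric])
          also have "\<dots> \<le> d x powr Q * \<tau> powr (s i - Q)"
            using False \<tau> s_le_Q by (intro mult_left_mono powr_mono2') auto
          finally show ?thesis using powr_ge_zero[of \<tau> "s i"] by linarith
        qed
      qed
      also have "\<dots> = real m * P * \<tau> powr s i + (\<Sum>x\<in>G. d x powr Q) * \<tau> powr (s i - Q)"
        by (simp add: sum.distrib sum_distrib_right[symmetric] G_def P_def card_cartesian_product mult_ac)
      also have "\<dots> \<le> real m * P * \<tau> powr s i + V * \<tau> powr (s i - Q)"
        using dQ by (simp add: mult_right_mono)
      finally show ?thesis .
    qed
    moreover have "c * real m powr (Q - 1) \<le> P"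
    proof -
      have "Q - 1 = (\<Sum>(i, j)\<in>I'. s i)" using Q_split by linarith
      then have "c * real m powr (Q - 1) = (\<Prod>(i, j)\<in>I'. \<theta> i / L powr s i) * (\<Prod>(i, j)\<in>I'. real m powr s i)"
        using m fI by (simp add: c_def powr_sum case_prod_beta)
      also have "\<dots> = (\<Prod>(i, j)\<in>I'. \<theta> i / \<epsilon> powr s i)"
        unfolding prod.distrib[symmetric] case_prod_beta
        using m L by (intro prod.cong) (auto simp: \<epsilon>_def powr_divide)
      also have "\<dots> \<le> (\<Prod>(i, j)\<in>I'. real (N i))"
        unfolding case_prod_beta
      proof (intro prod_mono conjI)
        fix x assume "x \<in> I'"
        then have "0 < \<theta> (fst x)" using \<theta> by (auto simp: I'_def)
        then show "0 \<le> \<theta> (fst x) / \<epsilon> powr s (fst x)" by simp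
        show "\<theta> (fst x) / \<epsilon> powr s (fst x) \<le> real (N (fst x))" unfolding N_def by linarith
      qed
      also have "\<dots> = P"
        using fI by (simp add: P_def C_def card_PiE case_prod_beta)
      finally show ?thesis .
    qed
    ultimately show ?thesis by blast
  qed
  then show False using counting_contradiction[OF a c si s_le_Q] by blast
qed


text \<open>A negative translation is a positive one read from its other end. The coordinates of
  block 0 are then changed from \<open>x\<close> to \<open>y\<close> one at a time.\<close>

lemma weakly_qs_leaf_preserving:
  assumes F: "bij_betw F X X" "weakly_qs A F" "1 \<le> A" "dcontinuous_on D X D F"
    and X: "x \<in> X" "y \<in> X" and l: "same_leaf x y"
  shows "same_leaf (F x) (F y)"
proof -
  have r0: "0 < r" using r2 by simp
  have FX: "F u \<in> X" if "u \<in> X" for u using F(1) that bij_betwE by blast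
  have pos: "same_leaf (F u) (F (translate 0 j t u))" if u: "u \<in> X" "j < ns 0" "0 < t" for u j t
    unfolding same_leaf_def
  proof (intro allI impI)
    fix i k :: nat assume "i \<noteq> 0"
    have tX: "translate 0 j t u \<in> X" using u r0 by (simp add: translate_in_X)
    show "F u i k = F (translate 0 j t u) i k"
    proof (cases "i < r \<and> k < ns i")
      case True
      then show ?thesis using leaf_coordinate_step[OF F u(1,3,2), of i k] \<open>i \<noteq> 0\<close> by simp
    next
      case False
      then show ?thesis using FX[OF u(1)] FX[OF tX] by (auto simp: pspace_def not_less)
    qed
  qed
  have step: "same_leaf (F u) (F (translate 0 j t u))" if u: "u \<in> X" "j < ns 0" for u j t
  proof -
    have inv: "translate 0 j (- t) (translate 0 j t u) = u" by (auto simp: translate_def)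
    consider "0 < t" | "t = 0" | "0 < - t" by linarith
    then show ?thesis
    proof cases
      case 3
      then show ?thesis
        using pos[of "translate 0 j t u" j "- t"] u r0 by (simp add: inv translate_in_X same_leaf_sym)
    qed (use pos u in \<open>auto simp: translate_def\<close>)
  qed
  define z where "z n = (\<lambda>i j. if i = 0 \<and> j < n then y i j else x i j)" for n :: nat
  have "z n \<in> X \<and> same_leaf (F x) (F (z n))" if "n \<le> ns 0" for n
    using that
  proof (induction n)
    case 0
    then show ?case using X by (simp add: z_def)
  next
    case (Suc n)
    have "z (Suc n) = translate 0 n (y 0 n - x 0 n) (z n)"
      by (intro ext) (auto simp: z_def translate_def less_Suc_eq)
    then show ?case
      using Suc step[of "z n" n] r0 translate_in_X[of "z n" 0 n] same_leaf_trans by auto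
  qed
  moreover have "z (ns 0) = y"
    using X l unfolding z_def same_leaf_def pspace_def
    by (intro ext) (metis (mono_tags, lifting) mem_Collect_eq not_less)
  ultimately show ?thesis by auto
qed

section \<open>From quasisymmetry to weak quasisymmetry of the map and its inverse\<close>

lemma quasisymmetric_imp_weakly_qs:
  assumes qs: "quasisymmetric \<eta> D X D X F"
    and mono: "\<And>s t. 0 \<le> s \<Longrightarrow> s \<le> t \<Longrightarrow> \<eta> s \<le> \<eta> t"
  shows "1 \<le> \<eta> 1" and "weakly_qs (\<eta> 1) F"
proof -
  have F: "bij_betw F X X" and
    q: "\<And>x y z. x \<in> X \<Longrightarrow> y \<in> X \<Longrightarrow> z \<in> X \<Longrightarrow> x \<noteq> y \<Longrightarrow> x \<noteq> z \<Longrightarrow> y \<noteq> z \<Longrightarrow>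
      D (F x) (F y) / D (F x) (F z) \<le> \<eta> (D x y / D x z)"
    using qs by (auto simp: quasisymmetric_def dhomeomorphism_def)
  have pos: "0 < D (F x) (F y)" if "x \<in> X" "y \<in> X" "x \<noteq> y" for x y
  proof -
    have "F x \<in> X" "F y \<in> X" "F x \<noteq> F y"
      using F that by (auto simp: bij_betw_def inj_on_def)
    then show ?thesis by (simp add: D_pos_iff)
  qed
  have le: "D (F x) (F y) \<le> \<eta> 1 * D (F x) (F z)"
    if "x \<in> X" "y \<in> X" "z \<in> X" "x \<noteq> y" "x \<noteq> z" "y \<noteq> z" "D x y \<le> D x z" for x y z
  proof -
    have "D x y / D x z \<le> 1" using that D_pos_iff[of x z] by (simp add: divide_le_eq_1)
    then have "D (F x) (F y) / D (F x) (F z) \<le> \<eta> 1"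
      using q[OF that(1-6)] mono[of "D x y / D x z" 1] by simp
    then show ?thesis using pos[of x z] that by (simp add: divide_le_eq)
  qed
  show A: "1 \<le> \<eta> 1"
  proof -
    \<comment> \<open>Two distinct points at distance 1 from the origin, found in blocks 0 and 1;
      comparing their images in both orders forces \<open>1 \<le> \<eta> 1\<close>.\<close>
    define x y z where "x = (\<lambda>(_::nat) (_::nat). 0 :: real)" and "y = translate 0 0 1 (\<lambda>_ _. 0)"
      and "z = translate 1 0 1 (\<lambda>_ _. 0)"
    have idx: "0 < r" "1 < r" "0 < ns 0" "0 < ns 1" using r2 ns_pos by (auto simp: Suc_le_eq)
    have xX: "x \<in> X" by (simp add: x_def pspace_def)
    then have X: "y \<in> X" "z \<in> X" using idx unfolding y_def z_def x_def
      by (blast intro: translate_in_X)+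
    have D: "D x y = 1" "D x z = 1"
      using D_translate[of 0 0 1 x] D_translate[of 1 0 1 x] idx by (simp_all add: x_def y_def z_def)
    have "y 0 0 \<noteq> z 0 0" by (simp add: y_def z_def translate_def)
    then have ne: "x \<noteq> y" "x \<noteq> z" "y \<noteq> z" using D by auto
    have "D (F x) (F y) \<le> \<eta> 1 * D (F x) (F z)" "D (F x) (F z) \<le> \<eta> 1 * D (F x) (F y)"
      using le[of x y z] le[of x z y] xX X ne D by auto
    moreover have "0 < D (F x) (F y)" "0 < D (F x) (F z)" using pos xX X ne by auto
    ultimately show ?thesis by (smt (verit) mult_left_le_one_le mult_nonneg_nonneg mult_less_cancel_right2)
  qed
  show "weakly_qs (\<eta> 1) F" unfolding weakly_qs_def
  proof (intro ballI impI)
    fix x y z assume x: "x \<in> X" "y \<in> X" "z \<in> X" and xyz: "D x y \<le> D x z"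
    consider "x = y" | "x \<noteq> y" "y = z" | "x \<noteq> y" "y \<noteq> z" by blast
    then show "D (F x) (F y) \<le> \<eta> 1 * D (F x) (F z)"
    proof cases
      case 3
      then have "x \<noteq> z" using xyz D_pos_iff[of x y] x by auto
      then show ?thesis using le x xyz 3 by blast
    next
      case 2
      then show ?thesis using A mult_right_mono[OF A D_nonneg, of "F x" "F z"] by simp
    qed (use A in simp)
  qed
qed

text \<open>If \<open>D x z\<close> were below \<open>b * D x y\<close>, then \<eta> of the quotient
  would be below 1, giving \<open>D u w < D u v\<close>. The intended \<open>b\<close> is the point
  where \<eta> equals 1.\<close>

lemma quasisymmetric_imp_weakly_qs_inverse:
  assumes qs: "quasisymmetric \<eta> D X D X F"
    and mono: "\<And>t. 0 \<le> t \<Longrightarrow> t < b \<Longrightarrow> \<eta> t < 1"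
    and b: "0 < b" "b \<le> 1"
  shows "weakly_qs (1 / b) (inv_into X F)"
  unfolding weakly_qs_def
proof (intro ballI impI)
  have F: "bij_betw F X X" and
    q: "\<And>x y z. x \<in> X \<Longrightarrow> y \<in> X \<Longrightarrow> z \<in> X \<Longrightarrow> x \<noteq> y \<Longrightarrow> x \<noteq> z \<Longrightarrow> y \<noteq> z \<Longrightarrow>
      D (F x) (F y) / D (F x) (F z) \<le> \<eta> (D x y / D x z)"
    using qs by (auto simp: quasisymmetric_def dhomeomorphism_def)
  fix u v w assume X: "u \<in> X" "v \<in> X" "w \<in> X" and le: "D u v \<le> D u w"
  define x y z where "x = inv_into X F u" and "y = inv_into X F v" and "z = inv_into X F w"
  have xX: "x \<in> X" "y \<in> X" "z \<in> X" and Fx: "F x = u" "F y = v" "F z = w"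
    using X F by (auto simp: x_def y_def z_def bij_betw_inv_into_right bij_betw_def inv_into_into)
  have "b * D x y \<le> D x z"
  proof (rule ccontr)
    assume *: "\<not> ?thesis"
    then have xy: "x \<noteq> y" by auto
    then have uv: "0 < D u v" using F xX Fx X by (auto simp: D_pos_iff bij_betw_def inj_on_def)
    then have xz: "x \<noteq> z" using le Fx by auto
    \<comment> \<open>Here \<open>b \<le> 1\<close> enters: \<open>y = z\<close> would give
      \<open>D x y < b * D x y\<close>.\<close>
    have yz: "y \<noteq> z" using * b by (auto simp: mult_left_le_one_le)
    have "D x z / D x y < b" using * D_pos_iff[of x y] xX xy by (simp add: divide_less_eq not_le)
    then have "D u w / D u v < 1"
      using mono[of "D x z / D x y"] q[of x z y] xX xy xz yz Fx by auto
    then show False using uv le by simp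
  qed
  then show "D x y \<le> 1 / b * D x z" using b by (simp add: field_simps)
qed

end

text \<open>A continuous injection is monotone on intervals. The value 0 cannot be taken at
  \<open>t > 0\<close>, as it would lie strictly between the values at \<open>0\<close> and
  \<open>2 * t\<close>, one of them negative; so \<open>f 0 = 0\<close> and \<open>f\<close>
  increases.\<close>

lemma homeomorphism_halfline_strict_mono:
  fixes f g :: "real \<Rightarrow> real"
  assumes "homeomorphism {0..} {0..} f g" "0 \<le> x" "x < y"
  shows "f x < f y"
proof -
  have cont: "continuous_on {0..} f" and im: "f ` {0..} = {0..}" and inj: "inj_on f {0..}"
    using assms(1) by (auto simp: homeomorphism_def intro: inj_on_inverseI)
  have nn: "0 \<le> f t" if "0 \<le> t" for t using im that by auto
  have mono: "f u < f v \<and> f v < f w \<or> f w < f v \<and> f v < f u" if "0 \<le> u" "u < v" "v < w" for u v w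
    using that inj_on_subset[OF inj, of "{u..w}"] continuous_on_subset[OF cont, of "{u..w}"]
      continuous_inj_imp_mono[of u v w f] by auto
  obtain t where t: "0 \<le> t" "f t = 0" using im by (metis atLeast_iff imageE order_refl)
  have "t = 0"
  proof (rule ccontr)
    assume "t \<noteq> 0"
    then show False using mono[of 0 t "2 * t"] t nn[of 0] nn[of "2 * t"] by auto
  qed
  then have f0: "f 0 = 0" using t by simp
  show ?thesis
  proof (cases "x = 0")
    case True
    have "f y \<noteq> f 0" using inj assms inj_onD[of f "{0..}" y 0] by auto
    then show ?thesis using True f0 nn[of y] assms by auto
  next
    case False
    then show ?thesis using mono[of 0 x y] f0 nn[of x] assms by auto
  qed
qed

section \<open>The global constant and the comparison of exponents\<close>

theorem theorem4p1:
  fixes ns :: "nat \<Rightarrow> nat" and r :: nat and \<alpha> :: "nat \<Rightarrow> real"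
    and \<eta> \<eta>' :: "real \<Rightarrow> real"
    and F :: "(nat \<Rightarrow> nat \<Rightarrow> real) \<Rightarrow> (nat \<Rightarrow> nat \<Rightarrow> real)"
  assumes r2: "r \<ge> 2"
    and ns_pos: "\<forall>i<r. ns i \<ge> 1"
    and alpha_pos: "0 < \<alpha> 0"
    and alpha_mono: "\<forall>i j. i < j \<and> j < r \<longrightarrow> \<alpha> i < \<alpha> j"
    and eta_homeo: "homeomorphism {0..} {0..} \<eta> \<eta>'"
    and F_qs: "quasisymmetric \<eta> (Dmet \<alpha> ns r) (pspace ns r) (Dmet \<alpha> ns r) (pspace ns r) F"
  shows "\<exists>C>0. quasisimilarity ((\<eta> 1 / \<eta>' 1) ^ (2 * r + 2)) C
            (Dmet \<alpha> ns r) (pspace ns r) (Dmet \<alpha> ns r) (pspace ns r) F"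
proof -
  interpret block_space ns r \<alpha> by unfold_locales (fact assms)+
  note mono = homeomorphism_halfline_strict_mono[OF eta_homeo]
  define A B where "A = \<eta> 1" and "B = \<eta>' 1"
  have "\<eta> s \<le> \<eta> t" if "0 \<le> s" "s \<le> t" for s t using mono[of s t] that by (cases "s = t") auto
  note A = quasisymmetric_imp_weakly_qs[OF F_qs this, folded A_def]
  have B: "0 \<le> B" "\<eta> B = 1" using eta_homeo unfolding homeomorphism_def B_def by auto
  have B1: "B \<le> 1" using mono[of 1 B] A(1) B(2) unfolding A_def by linarith
  have "B \<noteq> 0"
  proof
    assume "B = 0"
    obtain t where "0 \<le> t" "\<eta> t = 0" using eta_homeo unfolding homeomorphism_def by (metis atLeast_iff imageE order_refl)
    then show False using mono[of 0 t] B(2) \<open>B = 0\<close> by (cases "t = 0") auto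
  qed
  then have B0: "0 < B" using B(1) by simp
  have Binv: "weakly_qs (1 / B) (inv_into X F)"
    using mono[of _ B] B(2) B0 B1 by (intro quasisymmetric_imp_weakly_qs_inverse[OF F_qs]) auto
  have F: "bij_betw F X X" "dcontinuous_on D X D F" "dcontinuous_on D X D (inv_into X F)"
    using F_qs by (auto simp: quasisymmetric_def dhomeomorphism_def)
  have FX: "F x \<in> X" if "x \<in> X" for x using F(1) that bij_betwE by blast
  \<comment> \<open>The converse implication is leaf preservation for the inverse, with constant
    \<open>1 / B\<close>.\<close>
  have leaf: "same_leaf (F x) (F y) \<longleftrightarrow> same_leaf x y" if "x \<in> X" "y \<in> X" for x y
    using weakly_qs_leaf_preserving[OF F(1) A(2,1) F(2) that]
      weakly_qs_leaf_preserving[OF bij_betw_inv_into[OF F(1)] Binv _ F(3) FX[OF that(1)] FX[OF that(2)]]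
      B0 B1 that bij_betw_inv_into_left[OF F(1)] by auto
  have A0: "0 \<le> A" using A by simp
  note ratio = ratio_comparison[OF F(1) A(2) A0 leaf]

  define K where "K = (\<eta> 1 / \<eta>' 1) ^ (2 * r + 2)"
  \<comment> \<open>Since \<open>0 < B \<le> 1 \<le> A\<close> and \<open>r \<ge> 2\<close>, the
    exponent \<open>2 * r + 2\<close> is at least 6, so the claimed constant dominates
    \<open>A ^ 4\<close>.\<close>
  have "A \<le> A / B" using A(1) B0 B1 by (simp add: le_divide_eq mult_le_cancel_left1)
  then have "A ^ 4 \<le> (A / B) ^ 4" "1 \<le> A / B" using A(1) by (auto intro: power_mono)
  then have "A ^ 4 \<le> (A / B) ^ (2 * r + 2)"
    using power_increasing[of 4 "2 * r + 2" "A / B"] r2 by linarith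
  then have K: "A ^ 4 \<le> K" by (simp add: K_def A_def B_def)
  have A4: "1 \<le> A ^ 4" using A(1) by simp

  define S where "S = (\<lambda>(x, y). D (F x) (F y) / D x y) ` {(x, y). x \<in> X \<and> y \<in> X \<and> x \<noteq> y}"
  \<comment> \<open>All ratios lie between \<mu> and \<open>A ^ 8 * \<mu>\<close>; their geometric
    mean \<open>A ^ 4 * \<mu>\<close> is the constant \<open>C\<close>.\<close>
  define \<mu> where "\<mu> = Inf S"
  obtain p q where pq: "p \<in> X" "q \<in> X" "p \<noteq> q"
  proof
    have "D (\<lambda>_ _. 0) (translate 0 0 1 (\<lambda>_ _. 0)) = 1"
      using D_translate[of 0 0 1 "\<lambda>_ _. 0"] r2 ns_pos alpha_pos by (simp add: Suc_le_eq)
    then show "(\<lambda>_ _. 0) \<noteq> translate 0 0 1 (\<lambda>_ _. 0)" using D_self by auto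
    show "(\<lambda>_ _. 0) \<in> X" by (simp add: pspace_def)
    then show "translate 0 0 1 (\<lambda>_ _. 0) \<in> X"
      using r2 ns_pos by (intro translate_in_X) (auto simp: Suc_le_eq)
  qed
  have lower: "\<mu> \<le> D (F x) (F y) / D x y" if "x \<in> X" "y \<in> X" "x \<noteq> y" for x y
    unfolding \<mu>_def using that by (intro cInf_lower bdd_belowI[of _ 0]) (auto simp: S_def)
  have upper: "D (F x) (F y) / D x y \<le> A ^ 8 * \<mu>" if "x \<in> X" "y \<in> X" "x \<noteq> y" for x y
  proof -
    have "D (F x) (F y) / D x y / A ^ 8 \<le> \<mu>" unfolding \<mu>_def
    proof (rule cInf_greatest)
      show "S \<noteq> {}" using pq by (auto simp: S_def)
      fix t assume "t \<in> S"
      then have "D (F x) (F y) / D x y \<le> A ^ 8 * t" using ratio that by (auto simp: S_def)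
      moreover have "0 < A ^ 8" using A(1) by simp
      ultimately show "D (F x) (F y) / D x y / A ^ 8 \<le> t"
        by (simp only: pos_divide_le_eq mult.commute)
    qed
    moreover have "0 < A ^ 8" using A(1) by simp
    ultimately show ?thesis by (simp only: pos_divide_le_eq mult.commute)
  qed
  have "0 < D (F p) (F q) / D p q"
    using pq FX F(1) by (intro divide_pos_pos) (auto simp: D_pos_iff bij_betw_def inj_on_def)
  \<comment> \<open>Otherwise the upper bound would make the positive ratio of \<open>p\<close> and
    \<open>q\<close> nonpositive.\<close>
  then have \<mu>: "0 < \<mu>"
    using upper[OF pq] A0 by (smt (verit) mult_nonneg_nonpos zero_le_power)
  show ?thesis
  proof (intro exI conjI)
    show C: "0 < A ^ 4 * \<mu>" using A4 \<mu> by (intro mult_pos_pos) linarith+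
    show "quasisimilarity ((\<eta> 1 / \<eta>' 1) ^ (2 * r + 2)) (A ^ 4 * \<mu>) D X D X F"
      unfolding quasisimilarity_def K_def[symmetric]
    proof (intro conjI ballI F(1))
      fix x y assume X: "x \<in> X" "y \<in> X"
      have K0: "0 < K" using K A4 by linarith
      have c: "A ^ 4 * \<mu> / K \<le> \<mu>" "A ^ 8 * \<mu> \<le> A ^ 4 * \<mu> * K"
      proof -
        show "A ^ 4 * \<mu> / K \<le> \<mu>" using K K0 \<mu> by (simp add: divide_le_eq mult.commute)
        have "A ^ 8 * \<mu> = A ^ 4 * \<mu> * A ^ 4" by simp
        also have "\<dots> \<le> A ^ 4 * \<mu> * K" using K C by (intro mult_left_mono) auto
        finally show "A ^ 8 * \<mu> \<le> A ^ 4 * \<mu> * K" .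
      qed
      have "A ^ 4 * \<mu> / K * D x y \<le> D (F x) (F y) \<and> D (F x) (F y) \<le> A ^ 4 * \<mu> * K * D x y"
      proof (cases "x = y")
        case False
        then have "0 < D x y" using X by (simp add: D_pos_iff)
        moreover have "A ^ 4 * \<mu> / K \<le> D (F x) (F y) / D x y" "D (F x) (F y) / D x y \<le> A ^ 4 * \<mu> * K"
          using lower[OF X False] upper[OF X False] c by linarith+
        ultimately show ?thesis by (simp add: pos_le_divide_eq pos_divide_le_eq)
      qed simp
      then show "A ^ 4 * \<mu> / K * D x y \<le> D (F x) (F y)" "D (F x) (F y) \<le> A ^ 4 * \<mu> * K * D x y" by auto
    qed
  qed
qed

end
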